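(* Let $A=\{\mathbf a_1,\dots,\mathbf a_n\}\subset\mathbb Z^d$ be a finite set generating $\mathbb Z^d$ as a lattice, let $Q$ be the semigroup generated by $A$, let $K=\mathrm{cone}(A)$, assumed pointed with non-empty interior, and let $B$ be the Hilbert basis of $K$. A face $F$ of $K$ is nowhere saturated if and only if for some element $\mathbf b\in B$ the system $$\mathbf b=x_1\mathbf a_1+\dots+x_n\mathbf a_n,\quad x_j\in\mathbb Z\ \text{for all } j,\ \text{and } x_j\ge 0 \text{ for every } j \text{ with } \mathbf a_j\notin F$$ does not have a feasible solution.
   Context: $Q=\{\sum_i\lambda_i\mathbf a_i:\lambda_i\in\mathbb N\}$, $K=\{\sum_i\lambda_i\mathbf a_i:\lambda_i\in\mathbb R_{\ge0}\}$, $Q_{\rm sat}=K\cap\mathbb Z^d$. The Hilbert basis $B$ of $K$ is the unique minimal finite subset of $K\cap\mathbb Z^d$ generating $K\cap\mathbb Z^d$ as a semigroup. A point $\mathbf a\in Q$ is a saturation point if $\mathbf a+Q_{\rm sat}\subset Q$. A face $F$ of $K$ is almost saturated if it contains a saturation point of $Q$, and nowhere saturated otherwise. *)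

theory Defs
  imports "HOL-Analysis.Analysis"
begin

text \<open>\<open>\<int>\<^sup>d\<close> is the set of integral vectors of \<^typ>\<open>real ^ 'd\<close>, so that semigroups, lattices and cones
  live in the same space. A finite set \<open>A = {a\<^sub>1, \<dots>, a\<^sub>n}\<close> serves as its own index set:
  coefficient vectors are functions on \<open>A\<close>.\<close>

definition integer_points :: "(real ^ 'd) set" where
  "integer_points = {x. \<forall>i. x $ i \<in> \<int>}"

definition semigroup_gen :: "(real ^ 'd) set \<Rightarrow> (real ^ 'd) set" where
  "semigroup_gen A = {\<Sum>a\<in>A. of_nat (l a) *\<^sub>R a | l :: real ^ 'd \<Rightarrow> nat. True}"

definition lattice_gen :: "(real ^ 'd) set \<Rightarrow> (real ^ 'd) set" where
  "lattice_gen A = {\<Sum>a\<in>A. of_int (z a) *\<^sub>R a | z :: real ^ 'd \<Rightarrow> int. True}"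

definition cone_gen :: "(real ^ 'd) set \<Rightarrow> (real ^ 'd) set" where
  "cone_gen A = {\<Sum>a\<in>A. l a *\<^sub>R a | l :: real ^ 'd \<Rightarrow> real. \<forall>a\<in>A. 0 \<le> l a}"

definition pointed_cone :: "(real ^ 'd) set \<Rightarrow> bool" where
  "pointed_cone K \<longleftrightarrow> K \<inter> uminus ` K = {0}"

definition saturation :: "(real ^ 'd) set \<Rightarrow> (real ^ 'd) set" where
  "saturation A = cone_gen A \<inter> integer_points"

definition finitely_generates_points :: "(real ^ 'd) set \<Rightarrow> (real ^ 'd) set \<Rightarrow> bool" where
  "finitely_generates_points K B \<longleftrightarrow>
     finite B \<and> B \<subseteq> K \<inter> integer_points \<and> semigroup_gen B = K \<inter> integer_points"

text \<open>The description determines a set when \<open>K\<close> is a pointed rational polyhedral cone: existence is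
  Gordan's lemma, and uniqueness follows from pointedness. Since \<^const>\<open>semigroup_gen\<close> includes the
  empty sum, \<open>0\<close> is never an element.\<close>

definition hilbert_basis :: "(real ^ 'd) set \<Rightarrow> (real ^ 'd) set" where
  "hilbert_basis K = (THE B. finitely_generates_points K B \<and>
     (\<forall>B'. B' \<subset> B \<longrightarrow> \<not> finitely_generates_points K B'))"

definition saturation_point :: "(real ^ 'd) set \<Rightarrow> real ^ 'd \<Rightarrow> bool" where
  "saturation_point A p \<longleftrightarrow>
     p \<in> semigroup_gen A \<and> (\<forall>q\<in>saturation A. p + q \<in> semigroup_gen A)"

definition almost_saturated :: "(real ^ 'd) set \<Rightarrow> (real ^ 'd) set \<Rightarrow> bool" where
  "almost_saturated A F \<longleftrightarrow> (\<exists>p\<in>F. saturation_point A p)"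

definition nowhere_saturated :: "(real ^ 'd) set \<Rightarrow> (real ^ 'd) set \<Rightarrow> bool" where
  "nowhere_saturated A F \<longleftrightarrow> \<not> almost_saturated A F"

definition feasible :: "(real ^ 'd) set \<Rightarrow> (real ^ 'd) set \<Rightarrow> real ^ 'd \<Rightarrow> bool" where
  "feasible A F b \<longleftrightarrow>
     (\<exists>x :: real ^ 'd \<Rightarrow> int.
        b = (\<Sum>a\<in>A. of_int (x a) *\<^sub>R a) \<and> (\<forall>a\<in>A. a \<notin> F \<longrightarrow> 0 \<le> x a))"

end

theory Submission imports Defs
begin

text \<open>If \<open>p \<in> F\<close> is a saturation point then \<open>p + b \<in> Q\<close> for each \<open>b\<close> in the Hilbert basis, and only
  generators lying on \<open>F\<close> occur in \<open>p\<close>; subtracting \<open>p\<close> solves the system for \<open>b\<close>. Conversely, if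
  the system is solvable on the Hilbert basis it is solvable on all of \<open>Q\<^sub>s\<^sub>a\<^sub>t\<close>. Rounding down cone
  coefficients shows \<open>Q\<^sub>s\<^sub>a\<^sub>t = C + Q\<close> with \<open>C\<close> finite, and a large multiple of the sum of the
  generators on \<open>F\<close> makes the solutions for all of \<open>C\<close> simultaneously nonnegative.\<close>

subsection \<open>Finitely generated semigroups\<close>

lemma sum_in_semigroup_gen: "(\<Sum>a\<in>A. of_nat (l a) *\<^sub>R a) \<in> semigroup_gen A"
  unfolding semigroup_gen_def by (intro CollectI exI[of _ l]) simp

lemma zero_in_semigroup_gen [simp]: "0 \<in> semigroup_gen A"
  using sum_in_semigroup_gen[of "\<lambda>_. 0" A] by simp

lemma semigroup_gen_add:
  assumes "x \<in> semigroup_gen A" "y \<in> semigroup_gen A"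
  shows "x + y \<in> semigroup_gen A"
proof -
  obtain l m where "x = (\<Sum>a\<in>A. of_nat (l a) *\<^sub>R a)" "y = (\<Sum>a\<in>A. of_nat (m a) *\<^sub>R a)"
    using assms unfolding semigroup_gen_def by blast
  then have "x + y = (\<Sum>a\<in>A. of_nat (l a + m a) *\<^sub>R a)"
    by (simp add: sum.distrib scaleR_add_left)
  then show ?thesis using sum_in_semigroup_gen by metis
qed

lemma generator_in_semigroup_gen:
  assumes "finite A" "a \<in> A"
  shows "a \<in> semigroup_gen A"
proof -
  have "(\<Sum>c\<in>A. of_nat (if c = a then 1 else 0) *\<^sub>R c) = (\<Sum>c\<in>A. if c = a then c else 0)"
    by (intro sum.cong) auto
  also have "\<dots> = a" using assms by simp
  finally show ?thesis
    using sum_in_semigroup_gen[of "\<lambda>c. if c = a then 1 else 0" A] by (simp only:)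
qed

text \<open>A coefficient \<open>n\<close> amounts to \<open>n\<close> successive additions, so
  closure under adding one generator suffices. Later membership arguments can thus avoid coefficient
  functions.\<close>

lemma semigroup_gen_least:
  assumes "finite A" and zero: "0 \<in> S"
    and add: "\<And>a x. a \<in> A \<Longrightarrow> x \<in> S \<Longrightarrow> a + x \<in> S"
  shows "semigroup_gen A \<subseteq> S"
proof
  fix x assume "x \<in> semigroup_gen A"
  then obtain l where x: "x = (\<Sum>a\<in>A. of_nat (l a) *\<^sub>R a)"
    unfolding semigroup_gen_def by blast
  have multiple: "of_nat n *\<^sub>R a + y \<in> S" if "a \<in> A" "y \<in> S" for n :: nat and a y
  proof (induction n)
    case (Suc n)
    then show ?case using add[OF \<open>a \<in> A\<close> Suc] by (simp add: algebra_simps)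
  qed (use that in simp)
  have "(\<Sum>a\<in>C. of_nat (l a) *\<^sub>R a) \<in> S" if "C \<subseteq> A" for C
    using finite_subset[OF that \<open>finite A\<close>] that
    by (induction C rule: finite_induct) (auto intro: zero multiple)
  then show "x \<in> S" using x by blast
qed

lemma semigroup_gen_induct [consumes 2, case_names zero add]:
  assumes "finite A" "x \<in> semigroup_gen A" "P 0"
    and "\<And>a y. a \<in> A \<Longrightarrow> y \<in> semigroup_gen A \<Longrightarrow> P y \<Longrightarrow> P (a + y)"
  shows "P x"
proof -
  have "semigroup_gen A \<subseteq> {y \<in> semigroup_gen A. P y}"
    by (rule semigroup_gen_least) (use assms in \<open>auto intro: semigroup_gen_add generator_in_semigroup_gen\<close>)
  with assms(2) show ?thesis by blast
qed

lemma semigroup_gen_mono: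
  assumes "finite B" "A \<subseteq> B"
  shows "semigroup_gen A \<subseteq> semigroup_gen B"
proof (rule semigroup_gen_least)
  show "finite A" using finite_subset assms by blast
qed (use assms in \<open>auto intro: semigroup_gen_add generator_in_semigroup_gen\<close>)

lemma semigroup_gen_Diff_redundant:
  assumes "finite B" "b \<in> semigroup_gen (B - {b})"
  shows "semigroup_gen (B - {b}) = semigroup_gen B"
proof (rule antisym)
  show "semigroup_gen B \<subseteq> semigroup_gen (B - {b})"
  proof (rule semigroup_gen_least)
    fix a x assume "a \<in> B" "x \<in> semigroup_gen (B - {b})"
    then show "a + x \<in> semigroup_gen (B - {b})"
      using assms by (cases "a = b") (auto intro: semigroup_gen_add generator_in_semigroup_gen)
  qed (use assms in auto)
  show "semigroup_gen (B - {b}) \<subseteq> semigroup_gen B"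
    using assms(1) by (rule semigroup_gen_mono) blast
qed

text \<open>When \<open>x\<close> is built up one generator at a time, either \<open>b\<close> is
  never added or a copy of it can be moved to the front. This serves to show that elements of a
  minimal generating set are indecomposable.\<close>

lemma semigroup_gen_split_generator:
  assumes "finite B" "x \<in> semigroup_gen B" "b \<in> B"
  shows "x \<in> semigroup_gen (B - {b}) \<or> (\<exists>y\<in>semigroup_gen B. x = b + y)"
  using assms(1,2)
proof (induction rule: semigroup_gen_induct)
  case (add a y)
  show ?case
  proof (cases "a = b")
    case True
    then show ?thesis using add by blast
  next
    case False
    from add.IH show ?thesis
    proof
      assume "y \<in> semigroup_gen (B - {b})"
      then show ?thesis
        using False add assms(1) by (auto intro: semigroup_gen_add generator_in_semigroup_gen)
    next
      assume "\<exists>z\<in>semigroup_gen B. y = b + z"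
      then obtain z where "z \<in> semigroup_gen B" "a + y = b + (a + z)"
        by (auto simp: algebra_simps)
      then show ?thesis
        using add assms(1) by (blast intro: semigroup_gen_add generator_in_semigroup_gen)
    qed
  qed
qed simp

text \<open>\<open>B\<close> may contain \<open>0\<close>; adding \<open>0\<close> changes nothing,
  so the induction passes over it and keeps a nonzero summand found earlier.\<close>

lemma semigroup_gen_nonzero_cases:
  assumes "finite B" "x \<in> semigroup_gen B" "x \<noteq> 0"
  obtains b y where "b \<in> B" "b \<noteq> 0" "y \<in> semigroup_gen B" "x = b + y"
proof -
  have "x = 0 \<or> (\<exists>b\<in>B. b \<noteq> 0 \<and> (\<exists>y\<in>semigroup_gen B. x = b + y))"
    using assms(1,2)
  proof (induction rule: semigroup_gen_induct)
    case (add a y)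
    then show ?case by (cases "a = 0") auto
  qed simp
  with assms(3) that show thesis by blast
qed

subsection \<open>Cones and their integer points\<close>

lemma integer_points_add: "x \<in> integer_points \<Longrightarrow> y \<in> integer_points \<Longrightarrow> x + y \<in> integer_points"
  unfolding integer_points_def by simp

lemma integer_points_diff: "x \<in> integer_points \<Longrightarrow> y \<in> integer_points \<Longrightarrow> x - y \<in> integer_points"
  unfolding integer_points_def by simp

lemma zero_in_integer_points [simp]: "0 \<in> integer_points"
  unfolding integer_points_def by simp

text \<open>Each coordinate is bounded by the norm, which leaves finitely many integers for each of
  finitely many coordinates.\<close>

lemma finite_bounded_integer_points:
  assumes "bounded S"
  shows "finite (S \<inter> integer_points)"
proof -
  obtain M where M: "\<And>x. x \<in> S \<Longrightarrow> norm x \<le> M"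
    using assms unfolding bounded_iff by blast
  let ?T = "{k \<in> \<int>. \<bar>k\<bar> \<le> M}"
  have "x \<in> vec_lambda ` (UNIV \<rightarrow>\<^sub>E ?T)" if "x \<in> S \<inter> integer_points" for x
  proof (rule image_eqI)
    show "x = vec_lambda (vec_nth x)" by simp
    show "vec_nth x \<in> UNIV \<rightarrow>\<^sub>E ?T"
      using that M component_le_norm_cart[of x] order_trans
      unfolding integer_points_def by fastforce
  qed
  moreover have "finite (vec_lambda ` ((UNIV :: 'a set) \<rightarrow>\<^sub>E ?T))"
    by (intro finite_imageI finite_PiE finite_abs_int_segment) simp
  ultimately show ?thesis by (meson finite_subset subsetI)
qed

lemma cone_gen_add:
  assumes "x \<in> cone_gen A" "y \<in> cone_gen A"
  shows "x + y \<in> cone_gen A"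
proof -
  obtain l m where "\<forall>a\<in>A. 0 \<le> l a" "x = (\<Sum>a\<in>A. l a *\<^sub>R a)"
      "\<forall>a\<in>A. 0 \<le> m a" "y = (\<Sum>a\<in>A. m a *\<^sub>R a)"
    using assms unfolding cone_gen_def by blast
  then show ?thesis
    unfolding cone_gen_def
    by (intro CollectI exI[of _ "\<lambda>a. l a + m a"]) (simp add: sum.distrib scaleR_add_left)
qed

lemma conic_cone_gen: "conic (cone_gen A)"
  unfolding conic_def
proof (intro allI impI)
  fix x and c :: real
  assume "x \<in> cone_gen A" "0 \<le> c"
  then obtain l where "\<forall>a\<in>A. 0 \<le> l a" "x = (\<Sum>a\<in>A. l a *\<^sub>R a)"
    unfolding cone_gen_def by blast
  with \<open>0 \<le> c\<close> show "c *\<^sub>R x \<in> cone_gen A"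
    unfolding cone_gen_def
    by (intro CollectI exI[of _ "\<lambda>a. c * l a"]) (simp add: scaleR_sum_right)
qed

lemma semigroup_gen_subset_cone_gen: "semigroup_gen A \<subseteq> cone_gen A"
proof
  fix x assume "x \<in> semigroup_gen A"
  then obtain l where "x = (\<Sum>a\<in>A. of_nat (l a) *\<^sub>R a)"
    unfolding semigroup_gen_def by blast
  then show "x \<in> cone_gen A"
    unfolding cone_gen_def by (intro CollectI exI[of _ "\<lambda>a. of_nat (l a)"]) simp
qed

lemma zero_in_cone_gen [simp]: "0 \<in> cone_gen A"
  using semigroup_gen_subset_cone_gen zero_in_semigroup_gen by blast

lemma semigroup_gen_subset_integer_points:
  assumes "finite A" "A \<subseteq> integer_points"
  shows "semigroup_gen A \<subseteq> integer_points"
  by (rule semigroup_gen_least) (use assms in \<open>auto intro: integer_points_add\<close>)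

lemma zero_in_saturation [simp]: "0 \<in> saturation A"
  unfolding saturation_def by simp

lemma saturation_add: "x \<in> saturation A \<Longrightarrow> y \<in> saturation A \<Longrightarrow> x + y \<in> saturation A"
  unfolding saturation_def by (simp add: cone_gen_add integer_points_add)

text \<open>The core of Gordan's lemma: once the floors of the cone coefficients are split off, an
  integer point with coefficients in \<open>[0,1)\<close> remains, and such points form a bounded
  set.\<close>

lemma saturation_decomposition:
  assumes "finite A" "A \<subseteq> integer_points"
  obtains C where "finite C" "C \<subseteq> saturation A"
    "\<And>q. q \<in> saturation A \<Longrightarrow> \<exists>c\<in>C. \<exists>y\<in>semigroup_gen A. q = c + y"
proof -
  \<comment> \<open>The zonotope of \<open>A\<close>, the image of the closed unit cube; its integer
    points will serve as \<open>C\<close>.\<close>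
  define Z where "Z = (\<lambda>l. \<Sum>a\<in>A. l a *\<^sub>R a) ` {l. \<forall>a\<in>A. l a \<in> {0..1}}"
  have "norm x \<le> (\<Sum>a\<in>A. norm a)" if x: "x \<in> Z" for x
  proof -
    obtain l where l: "x = (\<Sum>a\<in>A. l a *\<^sub>R a)" "\<forall>a\<in>A. l a \<in> {0..1}"
      using x unfolding Z_def by blast
    show ?thesis
      unfolding l(1) using l(2) by (intro sum_norm_le) (simp add: mult_left_le_one_le)
  qed
  then have "bounded Z" unfolding bounded_iff by blast
  show thesis
  proof (rule that[of "Z \<inter> integer_points"])
    show "finite (Z \<inter> integer_points)"
      using \<open>bounded Z\<close> by (rule finite_bounded_integer_points)
    show "Z \<inter> integer_points \<subseteq> saturation A"
      unfolding Z_def saturation_def cone_gen_def by fastforce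
    fix q assume q: "q \<in> saturation A"
    then obtain l where l: "\<forall>a\<in>A. 0 \<le> l a" "q = (\<Sum>a\<in>A. l a *\<^sub>R a)"
      unfolding saturation_def cone_gen_def by blast
    define y where "y = (\<Sum>a\<in>A. of_nat (nat \<lfloor>l a\<rfloor>) *\<^sub>R a)"
    have y: "y \<in> semigroup_gen A" unfolding y_def by (rule sum_in_semigroup_gen)
    have "y = (\<Sum>a\<in>A. of_int \<lfloor>l a\<rfloor> *\<^sub>R a)"
      unfolding y_def using l(1) by (intro sum.cong) auto
    then have "q - y = (\<Sum>a\<in>A. frac (l a) *\<^sub>R a)"
      unfolding l(2) by (simp add: frac_def scaleR_diff_left sum_subtractf)
    then have "q - y \<in> Z"
      unfolding Z_def by (intro image_eqI[of _ _ "\<lambda>a. frac (l a)"]) (auto simp: less_imp_le[OF frac_lt_1])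
    moreover have "q - y \<in> integer_points"
      using q y semigroup_gen_subset_integer_points[OF assms] integer_points_diff
      unfolding saturation_def by blast
    ultimately show "\<exists>c\<in>Z \<inter> integer_points. \<exists>y\<in>semigroup_gen A. q = c + y"
      using y by (metis IntI diff_add_cancel)
  qed
qed

text \<open>Up to scaling, \<open>x + y\<close> is the midpoint of \<open>x\<close> and
  \<open>y\<close>, so the defining property of a face catches both summands. The converse holds
  because a face of a cone is itself a convex cone.\<close>

lemma add_in_face_of_cone_gen_iff:
  assumes F: "F face_of cone_gen A" and "x \<in> cone_gen A" "y \<in> cone_gen A"
  shows "x + y \<in> F \<longleftrightarrow> x \<in> F \<and> y \<in> F"
proof
  have conic: "conic F" using face_of_conic[OF conic_cone_gen F] .
  show "x \<in> F \<and> y \<in> F" if "x + y \<in> F"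
  proof -
    have mid: "midpoint x y \<in> F"
      using conicD[OF conic that, of "1/2"] by (simp add: midpoint_def)
    \<comment> \<open>The open segment is empty when \<open>x = y\<close>, but then the midpoint is
      \<open>x\<close> itself.\<close>
    show ?thesis
    proof (cases "x = y")
      case False
      then have "midpoint x y \<in> open_segment x y" by simp
      then show ?thesis using F mid assms(2,3) unfolding face_of_def by blast
    qed (use mid in simp)
  qed
  show "x + y \<in> F" if "x \<in> F \<and> y \<in> F"
  proof -
    have "(1/2) *\<^sub>R x + (1/2) *\<^sub>R y \<in> F"
      using that face_of_imp_convex[OF F] by (intro convexD) auto
    from conicD[OF conic this, of 2] show ?thesis by (simp add: algebra_simps)
  qed
qed

subsection \<open>The Hilbert basis\<close>

text \<open>Gordan's lemma: \<open>A\<close> together with the finitely many remainders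
  \<open>C\<close> generates all integer points of the cone.\<close>

lemma finite_generating_set_exists:
  assumes "finite A" "A \<subseteq> integer_points"
  shows "\<exists>B. finitely_generates_points (cone_gen A) B"
proof -
  obtain C where C: "finite C" "C \<subseteq> saturation A"
    "\<And>q. q \<in> saturation A \<Longrightarrow> \<exists>c\<in>C. \<exists>y\<in>semigroup_gen A. q = c + y"
    using saturation_decomposition[OF assms] by blast
  have A: "A \<subseteq> saturation A"
    using assms generator_in_semigroup_gen semigroup_gen_subset_cone_gen
    unfolding saturation_def by blast
  have fin: "finite (A \<union> C)" using assms(1) C(1) by simp
  have "semigroup_gen (A \<union> C) = saturation A"
  proof
    show "semigroup_gen (A \<union> C) \<subseteq> saturation A"
      by (rule semigroup_gen_least) (use fin A C(2) in \<open>auto intro: saturation_add\<close>)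
    show "saturation A \<subseteq> semigroup_gen (A \<union> C)"
    proof
      fix q assume "q \<in> saturation A"
      then obtain c y where "c \<in> C" "y \<in> semigroup_gen A" "q = c + y" using C(3) by blast
      moreover have "c \<in> semigroup_gen (A \<union> C)"
        using fin \<open>c \<in> C\<close> by (simp add: generator_in_semigroup_gen)
      ultimately show "q \<in> semigroup_gen (A \<union> C)"
        using semigroup_gen_mono[OF fin, of A] by (auto intro: semigroup_gen_add)
    qed
  qed
  then show ?thesis
    using fin A C(2) unfolding finitely_generates_points_def saturation_def by blast
qed

text \<open>Uniqueness: a minimal generating set is exactly the set of indecomposable elements.\<close>

lemma hilbert_basis_generates:
  assumes "finite A" "A \<subseteq> integer_points" and pointed: "pointed_cone (cone_gen A)"
  shows "finitely_generates_points (cone_gen A) (hilbert_basis (cone_gen A))"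
proof -
  let ?G = "finitely_generates_points (cone_gen A)"
  define Min where "Min B \<longleftrightarrow> ?G B \<and> (\<forall>B'. B' \<subset> B \<longrightarrow> \<not> ?G B')" for B
  \<comment> \<open>The indecomposable elements. Their definition mentions no generating set, so
    showing \<open>B = Irr\<close> for every minimal \<open>B\<close> yields uniqueness.\<close>
  define Irr where "Irr = {h \<in> saturation A. h \<noteq> 0 \<and>
    (\<forall>x\<in>saturation A. \<forall>y\<in>saturation A. h = x + y \<longrightarrow> x = 0 \<or> y = 0)}"
  have G_iff: "?G B \<longleftrightarrow> finite B \<and> B \<subseteq> saturation A \<and> semigroup_gen B = saturation A" for B
    unfolding finitely_generates_points_def saturation_def by (rule refl)
  have cancel: "y = 0" if "x \<in> saturation A" "y \<in> saturation A" "x + y = 0" for x y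
  proof -
    have "y = - x" using that(3) by (simp add: eq_neg_iff_add_eq_0 add.commute)
    then have "y \<in> cone_gen A \<inter> uminus ` cone_gen A"
      using that(1,2) unfolding saturation_def by blast
    then show ?thesis using pointed unfolding pointed_cone_def by blast
  qed
  \<comment> \<open>Splitting a nonzero generator off an indecomposable \<open>h\<close> forces the
    rest to vanish, so \<open>h\<close> is that generator.\<close>
  have Irr_sub: "Irr \<subseteq> B" if "?G B" for B
  proof
    fix h assume h: "h \<in> Irr"
    then have "finite B" "h \<in> semigroup_gen B" "h \<noteq> 0"
      using that unfolding G_iff Irr_def by auto
    then obtain b y where "b \<in> B" "b \<noteq> 0" "y \<in> semigroup_gen B" "h = b + y"
      by (rule semigroup_gen_nonzero_cases)
    moreover from this have "y = 0" using h that unfolding G_iff Irr_def by blast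
    ultimately show "h \<in> B" by simp
  qed
  have Min_sub: "B \<subseteq> Irr" if "Min B" for B
  proof
    fix b assume b: "b \<in> B"
    have B: "finite B" "B \<subseteq> saturation A" "semigroup_gen B = saturation A"
      using that unfolding Min_def G_iff by auto
    have not_redundant: "b \<notin> semigroup_gen (B - {b})"
    proof
      assume "b \<in> semigroup_gen (B - {b})"
      then have "?G (B - {b})"
        using B semigroup_gen_Diff_redundant[of B b] unfolding G_iff by auto
      moreover have "B - {b} \<subset> B" using b by blast
      ultimately show False using that unfolding Min_def by blast
    qed
    \<comment> \<open>If \<open>x\<close> cannot be written without \<open>b\<close>, then
      \<open>x = b + z\<close>, so \<open>b = b + z + y\<close> and pointedness kills
      \<open>z\<close> and \<open>y\<close>.\<close>
    have absorb: "y = 0"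
      if xy: "x \<in> saturation A" "y \<in> saturation A" "b = x + y" and x: "x \<notin> semigroup_gen (B - {b})" for x y
    proof -
      obtain z where z: "z \<in> saturation A" "x = b + z"
        using semigroup_gen_split_generator[OF B(1) _ b, of x] B(3) xy(1) x by auto
      then have "z + y = 0" using xy(3) by (simp add: add.commute)
      then show ?thesis using cancel z(1) xy(2) by blast
    qed
    \<comment> \<open>If both \<open>x\<close> and \<open>y\<close> could be written without
      \<open>b\<close>, so could \<open>b\<close>, against minimality. Hence \<open>absorb\<close>
      applies to one of them and makes the other \<open>0\<close>.\<close>
    have "x = 0 \<or> y = 0" if "x \<in> saturation A" "y \<in> saturation A" "b = x + y" for x y
      using absorb[of x y] absorb[of y x] that not_redundant semigroup_gen_add
      by (metis add.commute)
    moreover have "b \<noteq> 0" using not_redundant by auto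
    ultimately show "b \<in> Irr" using b B(2) unfolding Irr_def by blast
  qed
  obtain B0 where "?G B0" using finite_generating_set_exists[OF assms(1,2)] by blast
  \<comment> \<open>A generating set of least cardinality is also minimal under inclusion, which
    gives existence.\<close>
  define B where "B = arg_min card ?G"
  have B: "?G B" and least: "\<And>B'. ?G B' \<Longrightarrow> card B \<le> card B'"
    unfolding B_def using \<open>?G B0\<close> by (auto intro: arg_min_natI arg_min_nat_le)
  have "Min B"
    unfolding Min_def
    using B least psubset_card_mono unfolding G_iff by (metis leD)
  moreover have "B' = B" if "Min B'" for B'
    using Min_sub[OF that] Min_sub[OF \<open>Min B\<close>] Irr_sub[of B'] Irr_sub[of B] that \<open>Min B\<close>
    unfolding Min_def by blast
  ultimately have "Min (THE B. Min B)" by (metis theI)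
  then show ?thesis unfolding hilbert_basis_def Min_def by blast
qed

subsection \<open>Feasibility\<close>

lemma feasible_zero: "feasible A F 0"
  unfolding feasible_def by (intro exI[of _ "\<lambda>_. 0"]) simp

lemma feasible_add:
  assumes "feasible A F x" "feasible A F y"
  shows "feasible A F (x + y)"
proof -
  obtain u v where "x = (\<Sum>a\<in>A. of_int (u a) *\<^sub>R a)" "\<forall>a\<in>A. a \<notin> F \<longrightarrow> 0 \<le> u a"
      "y = (\<Sum>a\<in>A. of_int (v a) *\<^sub>R a)" "\<forall>a\<in>A. a \<notin> F \<longrightarrow> 0 \<le> v a"
    using assms unfolding feasible_def by blast
  then show ?thesis
    unfolding feasible_def
    by (intro exI[of _ "\<lambda>a. u a + v a"]) (simp add: sum.distrib scaleR_add_left)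
qed

text \<open>A point \<open>p\<close> of the face involves only generators on \<open>F\<close>, so
  subtracting it lowers only coefficients whose sign is unconstrained.\<close>

lemma feasible_diff:
  assumes "finite A" "F face_of cone_gen A"
    and p: "p \<in> F" "p \<in> semigroup_gen A" and q: "q \<in> semigroup_gen A"
  shows "feasible A F (q - p)"
proof -
  obtain l m where l: "p = (\<Sum>a\<in>A. of_nat (l a) *\<^sub>R a)" and m: "q = (\<Sum>a\<in>A. of_nat (m a) *\<^sub>R a)"
    using p(2) q unfolding semigroup_gen_def by blast
  have "l a = 0" if a: "a \<in> A" "a \<notin> F" for a
  proof (rule ccontr)
    assume "l a \<noteq> 0"
    \<comment> \<open>One copy of \<open>a\<close> is removed from the representation of
      \<open>p\<close>; then \<open>p = a + y\<close> with \<open>y\<close> in the semigroup, and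
      the face property puts \<open>a\<close> in \<open>F\<close>.\<close>
    define l' where "l' = l(a := l a - 1)"
    have "p = of_nat (l a) *\<^sub>R a + (\<Sum>c\<in>A-{a}. of_nat (l c) *\<^sub>R c)"
      unfolding l using assms(1) a(1) by (rule sum.remove)
    also have "\<dots> = a + (of_nat (l' a) *\<^sub>R a + (\<Sum>c\<in>A-{a}. of_nat (l' c) *\<^sub>R c))"
      using \<open>l a \<noteq> 0\<close> by (auto simp: l'_def of_nat_diff algebra_simps)
    also have "\<dots> = a + (\<Sum>c\<in>A. of_nat (l' c) *\<^sub>R c)"
      using sum.remove[OF assms(1) a(1), of "\<lambda>c. of_nat (l' c) *\<^sub>R c"] by simp
    finally obtain y where "y \<in> semigroup_gen A" "p = a + y"
      using sum_in_semigroup_gen by blast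
    then have "a \<in> F"
      using add_in_face_of_cone_gen_iff[OF assms(2), of a y] p(1) a(1)
        generator_in_semigroup_gen[OF assms(1)] semigroup_gen_subset_cone_gen by blast
    with a(2) show False ..
  qed
  then show ?thesis
    unfolding feasible_def l m
    by (intro exI[of _ "\<lambda>a. int (m a) - int (l a)"])
      (simp add: scaleR_diff_left sum_subtractf)
qed

text \<open>The added multiple raises by \<open>N\<close> exactly the coefficients that may be
  negative. Stating this for all large \<open>N\<close> lets one \<open>N\<close> serve finitely
  many \<open>c\<close> at once.\<close>

lemma feasible_eventually_in_semigroup_gen:
  assumes "finite A" "feasible A F c"
  shows "\<forall>\<^sub>F N in sequentially. of_nat N *\<^sub>R (\<Sum>a\<in>A \<inter> F. a) + c \<in> semigroup_gen A"
proof -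
  obtain x where x: "c = (\<Sum>a\<in>A. of_int (x a) *\<^sub>R a)" "\<forall>a\<in>A. a \<notin> F \<longrightarrow> 0 \<le> x a"
    using assms(2) unfolding feasible_def by blast
  show ?thesis
  proof (rule eventually_sequentiallyI)
    \<comment> \<open>The sum is a threshold that dominates every single
      \<open>\<bar>x a\<bar>\<close>.\<close>
    fix N assume N: "(\<Sum>a\<in>A. nat \<bar>x a\<bar>) \<le> N"
    define k where "k a = (if a \<in> F then int N else 0) + x a" for a
    have k: "0 \<le> k a" if "a \<in> A" for a
    proof -
      have "nat \<bar>x a\<bar> \<le> N" using member_le_sum[OF that, of "\<lambda>a. nat \<bar>x a\<bar>"] N assms(1) by simp
      then show ?thesis using x(2) that unfolding k_def by auto
    qed
    have "of_nat N *\<^sub>R (\<Sum>a\<in>A \<inter> F. a) = (\<Sum>a\<in>A. of_int (if a \<in> F then int N else 0) *\<^sub>R a)"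
      unfolding scaleR_sum_right sum.inter_restrict[OF assms(1)] by (intro sum.cong) auto
    then have "of_nat N *\<^sub>R (\<Sum>a\<in>A \<inter> F. a) + c = (\<Sum>a\<in>A. of_int (k a) *\<^sub>R a)"
      unfolding x(1) k_def by (simp only: sum.distrib scaleR_add_left of_int_add)
    also have "\<dots> = (\<Sum>a\<in>A. of_nat (nat (k a)) *\<^sub>R a)"
      using k by (intro sum.cong) auto
    finally show "of_nat N *\<^sub>R (\<Sum>a\<in>A \<inter> F. a) + c \<in> semigroup_gen A"
      by (simp only: sum_in_semigroup_gen)
  qed
qed

lemma almost_saturatedI:
  assumes A: "finite A" "A \<subseteq> integer_points"
    and F: "F face_of cone_gen A" "F \<noteq> {}"
    and feasible: "\<And>q. q \<in> saturation A \<Longrightarrow> feasible A F q"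
  shows "almost_saturated A F"
proof -
  obtain C where C: "finite C" "C \<subseteq> saturation A"
    "\<And>q. q \<in> saturation A \<Longrightarrow> \<exists>c\<in>C. \<exists>y\<in>semigroup_gen A. q = c + y"
    using saturation_decomposition[OF A] by blast
  let ?f = "\<Sum>a\<in>A \<inter> F. a"
  \<comment> \<open>Including \<open>0\<close> ensures that the candidate saturation point itself
    lies in the semigroup.\<close>
  have "\<forall>\<^sub>F N in sequentially. \<forall>c\<in>insert 0 C. of_nat N *\<^sub>R ?f + c \<in> semigroup_gen A"
    using C(1,2) feasible zero_in_saturation
    by (intro eventually_ball_finite ballI feasible_eventually_in_semigroup_gen[OF A(1)]) blast+
  then obtain N :: nat where N: "\<And>c. c \<in> insert 0 C \<Longrightarrow> of_nat N *\<^sub>R ?f + c \<in> semigroup_gen A"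
    using eventually_happens'[OF sequentially_bot] by blast
  have conic: "conic F" using face_of_conic[OF conic_cone_gen F(1)] .
  \<comment> \<open>This covers the case where no generator lies on \<open>F\<close> and
    \<open>?f\<close> is the empty sum.\<close>
  have "0 \<in> F" using conic F(2) conic_contains_0 by blast
  have "(\<Sum>a\<in>D. a) \<in> F" if "D \<subseteq> F" "finite D" for D
    using that(2,1)
  proof (induction D rule: finite_induct)
    case (insert a D)
    then show ?case
      using face_of_imp_subset[OF F(1)] add_in_face_of_cone_gen_iff[OF F(1), of a "\<Sum>D"] by auto
  qed (use \<open>0 \<in> F\<close> in simp)
  then have "?f \<in> F" using A(1) by simp
  then have "of_nat N *\<^sub>R ?f \<in> F" by (intro conicD[OF conic]) auto
  moreover have "saturation_point A (of_nat N *\<^sub>R ?f)"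
    unfolding saturation_point_def
  proof (intro conjI ballI)
    show "of_nat N *\<^sub>R ?f \<in> semigroup_gen A" using N[of 0] by simp
    \<comment> \<open>Only the remainder \<open>c\<close> needs the shift by \<open>N\<close>; the
      other summand \<open>y\<close> is already in the semigroup.\<close>
    fix q assume "q \<in> saturation A"
    then obtain c y where "c \<in> C" "y \<in> semigroup_gen A" "q = c + y" using C(3) by blast
    then show "of_nat N *\<^sub>R ?f + q \<in> semigroup_gen A"
      using semigroup_gen_add[OF N[of c], of y] by (simp add: add.assoc)
  qed
  ultimately show ?thesis unfolding almost_saturated_def by blast
qed

theorem theorem3p4:
  fixes A F :: "(real ^ 'd) set"
  assumes "finite A"
    and "A \<subseteq> integer_points"
    and "lattice_gen A = integer_points"
    and "pointed_cone (cone_gen A)"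
    and "interior (cone_gen A) \<noteq> {}"
    and "F face_of cone_gen A"
    and "F \<noteq> {}"
  shows "nowhere_saturated A F \<longleftrightarrow> (\<exists>b\<in>hilbert_basis (cone_gen A). \<not> feasible A F b)"
proof -
  let ?B = "hilbert_basis (cone_gen A)"
  have B: "finite ?B" "?B \<subseteq> saturation A" "semigroup_gen ?B = saturation A"
    using hilbert_basis_generates[OF assms(1,2,4)]
    unfolding finitely_generates_points_def saturation_def by auto
  have "almost_saturated A F \<longleftrightarrow> (\<forall>b\<in>?B. feasible A F b)"
  proof
    assume "almost_saturated A F"
    then obtain p where p: "p \<in> F" "saturation_point A p"
      unfolding almost_saturated_def by blast
    show "\<forall>b\<in>?B. feasible A F b"
    proof
      fix b assume "b \<in> ?B"
      then have "p + b \<in> semigroup_gen A" "p \<in> semigroup_gen A"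
        using p(2) B(2) unfolding saturation_point_def by auto
      \<comment> \<open>Here \<open>b\<close> is read as \<open>(p + b) - p\<close>.\<close>
      from feasible_diff[OF assms(1,6) p(1) this(2,1)] show "feasible A F b" by simp
    qed
  next
    assume "\<forall>b\<in>?B. feasible A F b"
    \<comment> \<open>Feasible right-hand sides contain \<open>0\<close> and are closed under
      addition, so feasibility spreads from the basis to the whole saturation.\<close>
    then have "semigroup_gen ?B \<subseteq> {q. feasible A F q}"
      using B(1) by (intro semigroup_gen_least) (auto intro: feasible_zero feasible_add)
    then show "almost_saturated A F"
      using B(3) by (intro almost_saturatedI[OF assms(1,2,6,7)]) auto
  qed
  then show ?thesis unfolding nowhere_saturated_def by blast
qed

end
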